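(* Let $X\sim N_p(\mu,\sigma_X^2 I_p)$ and $Y\sim N_p(\mu,\sigma_Y^2 I_p)$ be independent, with $\sigma_X^2,\sigma_Y^2>0$ known, $\mu\in\mathbb{R}^p$ unknown, and $r=\sigma_X^2/\sigma_Y^2$. For $c>0$ and a point estimator $\hat\mu(X)$ of $\mu$, let $\hat q_{c^2,\hat\mu}$ be the density of $N_p(\hat\mu(X),c^2\sigma_Y^2 I_p)$, viewed as an estimator of the density of $Y$ under integrated $L_2$ loss, with risk $R(\mu,\hat q_{c^2,\hat\mu})$. (a) For fixed $c^2$, the frequentist risk of the density estimator $\hat q_{c^2,\hat\mu}$ under integrated $L_2$ loss is equal to the frequentist risk of the point estimator $\hat\mu(X)$ of $\mu$ under the loss $a+b\,L_{\gamma_0}(\mu,\hat\mu)$, with $$a=\frac{1+c^p}{(4\pi c^2\sigma_Y^2)^{p/2}},\qquad b=\frac{2}{(2\pi(c^2+1)\sigma_Y^2)^{p/2}},\qquad \gamma_0=(c^2+1)\sigma_Y^2 .$$ Namely, $\hat q_{c^2,\hat\mu_1}$ improves on $\hat q_{c^2,\hat\mu_2}$ if and only if $\hat\mu_1(X)$ improves on $\hat\mu_2(X)$ under the reflected normal loss $L_{\gamma_0}(\mu,\hat\mu)$. (b) For $\hat\mu(X)=X$, the risk $R(\mu,\hat q_{c^2,\hat\mu})$ is constant as a function of $\mu$ and given by $$\frac{1}{(2\pi\sigma_Y^2)^{p/2}}\left(\Big(\frac12\Big)^{p/2}+\frac{1}{(2c^2)^{p/2}}-\frac{2}{(r+c^2+1)^{p/2}}\right).$$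 For all $p$, the constant (and minimax) risk of the minimum risk equivariant estimator $\hat q_{\rm mre}$, corresponding to the optimal choice $c^2=1+r$, is equal to $$R(\mu,\hat q_{\rm mre})=\frac{1}{(4\pi\sigma_Y^2)^{p/2}}-\frac{1}{(4\pi(\sigma_X^2+\sigma_Y^2))^{p/2}} .$$ (c) Furthermore, for $\hat\mu(X)=X$, all estimators $\hat q_{c^2,\hat\mu}$ with $c^2>1$ dominate the plug-in (or maximum likelihood) estimator $\hat q_{1,\hat\mu}$ whenever $p\ge p_0=\frac{\log 4}{\log(1+r/2)}$; and, otherwise, for $p<p_0$, the estimator $\hat q_{c^2,\hat\mu}$ dominates $\hat q_{1,\hat\mu}$ if and only if $1<c^2<k(p,r)$, where $k(p,r)$ is the unique solution on $(1,\infty)$ in $c^2$ of the equation $$\Big(\frac12\Big)^{p/2}+2\Big(\frac{1}{r+c^2+1}\Big)^{p/2}-2\Big(\frac{1}{r+2}\Big)^{p/2}-\Big(\frac{1}{2c^2}\Big)^{p/2}=0 .$$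
   Context: The integrated $L_2$ loss of an estimate $\hat q(\cdot;x)$ of the density $q(\cdot-\mu)$ of $Y$ is $\int_{\mathbb{R}^p}(q(y-\mu)-\hat q(y;x))^2\,dy$; the risk is its expectation over $X$. The reflected normal loss with parameter $\gamma>0$ is $L_\gamma(\mu,\hat\mu)=1-e^{-\|\hat\mu-\mu\|^2/(2\gamma)}$. One estimator dominates (improves on) another if its risk is $\le$ for all $\mu$ with strict inequality for some $\mu$. An estimator is minimax if it minimizes $\sup_\mu R(\mu,\cdot)$ among all predictive density estimators. An equivariant estimator is one satisfying $\hat q(y;x)=\hat q(y-x;0)$ for all $x,y\in\mathbb{R}^p$; such estimators have constant risk, and $\hat q_{\rm mre}$ is the one with the smallest risk; here it is the $N_p(X,(\sigma_X^2+\sigma_Y^2)I_p)$ density.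
   Formalization: In (a) the loss a + b L is corrected to (a − b) + b L, with a, b, γ₀ as given; the stated equality is always off by b > 0 (e.g. c = 1 and the estimator constantly equal to the true mean gives risk 0, not a > 0). *)

theory Defs
  imports "HOL-Probability.Probability"
begin

text \<open>Density of the normal distribution with mean \<open>m\<close> and covariance \<open>v\<close> times the identity
  (\<open>v\<close> is the variance of a coordinate, not the standard deviation).\<close>

definition gauss_density :: "'a::euclidean_space \<Rightarrow> real \<Rightarrow> 'a \<Rightarrow> real" where
  "gauss_density m v y =
     exp (- (norm (y - m))\<^sup>2 / (2 * v)) / (2 * pi * v) powr (real DIM('a) / 2)"

definition reflected_normal_loss :: "real \<Rightarrow> 'a::euclidean_space \<Rightarrow> 'a \<Rightarrow> real" where
  "reflected_normal_loss \<gamma> \<mu> m = 1 - exp (- (norm (m - \<mu>))\<^sup>2 / (2 * \<gamma>))"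

text \<open>The statistical experiment: the observable \<open>X\<close> is a fixed map on the sample space, and the
  parameter \<open>\<mu>\<close> selects the probability measure \<open>M \<mu>\<close>. The expectation of a point loss is a
  Bochner integral; it is only used for bounded losses and measurable estimators.\<close>

definition point_risk ::
    "('a::euclidean_space \<Rightarrow> 'w measure) \<Rightarrow> ('w \<Rightarrow> 'a) \<Rightarrow> ('a \<Rightarrow> 'a \<Rightarrow> real)
      \<Rightarrow> 'a \<Rightarrow> ('a \<Rightarrow> 'a) \<Rightarrow> real" where
  "point_risk M X L \<mu> d = (\<integral>\<omega>. L \<mu> (d (X \<omega>)) \<partial>M \<mu>)"

text \<open>A predictive density estimator is a map \<open>Q\<close>, where \<open>Q y x\<close> is the estimated density
  at \<open>y\<close> when \<open>x\<close> has been observed. Its loss and risk may be infinite.\<close>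

definition l2_loss :: "('a::euclidean_space \<Rightarrow> real) \<Rightarrow> ('a \<Rightarrow> real) \<Rightarrow> ennreal" where
  "l2_loss f g = (\<integral>\<^sup>+y. ennreal ((f y - g y)\<^sup>2) \<partial>lborel)"

definition density_risk ::
    "('a::euclidean_space \<Rightarrow> 'w measure) \<Rightarrow> ('w \<Rightarrow> 'a) \<Rightarrow> ('a \<Rightarrow> real)
      \<Rightarrow> 'a \<Rightarrow> ('a \<Rightarrow> 'a \<Rightarrow> real) \<Rightarrow> ennreal" where
  "density_risk M X q \<mu> Q =
     (\<integral>\<^sup>+\<omega>. l2_loss (\<lambda>y. q (y - \<mu>)) (\<lambda>y. Q y (X \<omega>)) \<partial>M \<mu>)"

definition density_estimator :: "('a::euclidean_space \<Rightarrow> 'a \<Rightarrow> real) \<Rightarrow> bool" where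
  "density_estimator Q \<longleftrightarrow>
     (\<lambda>(y, x). Q y x) \<in> borel_measurable borel \<and>
     (\<forall>y x. 0 \<le> Q y x) \<and>
     (\<forall>x. (\<integral>\<^sup>+y. ennreal (Q y x) \<partial>lborel) = 1)"

definition gauss_estimator ::
    "real \<Rightarrow> ('a::euclidean_space \<Rightarrow> 'a) \<Rightarrow> 'a \<Rightarrow> 'a \<Rightarrow> real" where
  "gauss_estimator v d y x = gauss_density (d x) v y"

text \<open>In the following definitions \<open>R \<mu> d\<close> is the risk of the procedure \<open>d\<close> at \<open>\<mu>\<close>.\<close>

definition dominates :: "('a \<Rightarrow> 'd \<Rightarrow> 'r::linorder) \<Rightarrow> 'd \<Rightarrow> 'd \<Rightarrow> bool" where
  "dominates R d1 d2 \<longleftrightarrow> (\<forall>\<mu>. R \<mu> d1 \<le> R \<mu> d2) \<and> (\<exists>\<mu>. R \<mu> d1 < R \<mu> d2)"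

definition minimax ::
    "('a::euclidean_space \<Rightarrow> ('a \<Rightarrow> 'a \<Rightarrow> real) \<Rightarrow> ennreal) \<Rightarrow> ('a \<Rightarrow> 'a \<Rightarrow> real) \<Rightarrow> bool" where
  "minimax R Q \<longleftrightarrow> density_estimator Q \<and>
     (\<forall>Q'. density_estimator Q' \<longrightarrow> (SUP \<mu>. R \<mu> Q) \<le> (SUP \<mu>. R \<mu> Q'))"

definition equivariant :: "('a::euclidean_space \<Rightarrow> 'a \<Rightarrow> real) \<Rightarrow> bool" where
  "equivariant Q \<longleftrightarrow> (\<forall>x y. Q y x = Q (y - x) 0)"

definition min_risk_equivariant ::
    "('a::euclidean_space \<Rightarrow> ('a \<Rightarrow> 'a \<Rightarrow> real) \<Rightarrow> ennreal) \<Rightarrow> ('a \<Rightarrow> 'a \<Rightarrow> real) \<Rightarrow> bool" where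
  "min_risk_equivariant R Q \<longleftrightarrow> density_estimator Q \<and> equivariant Q \<and>
     (\<forall>Q'. density_estimator Q' \<and> equivariant Q' \<longrightarrow> (\<forall>\<mu>. R \<mu> Q \<le> R \<mu> Q'))"

end

theory Submission
  imports Defs "HOL-Real_Asymp.Real_Asymp"
begin

text \<open>
  Write \<open>v\<close> and \<open>s\<close> for the variances of \<open>X\<close> and \<open>Y\<close>, and \<open>\<phi> m w\<close> for the density of the normal
  distribution with mean \<open>m\<close> and covariance \<open>w\<close> times the identity. The product of two Gaussian
  densities is again a multiple of a Gaussian density (\<open>gauss_density_mult\<close>), so the integrated
  squared error between \<open>\<phi> \<mu> s\<close> and \<open>\<phi> m w\<close> is a constant minus twice \<open>\<phi> \<mu> (s + w) m\<close>, that is,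
  an increasing affine function of the reflected normal loss at \<open>m\<close>. Taking expectations gives
  the correspondence with point estimation (\<open>density_risk_gauss_estimator\<close>).

  Everything about optimality rests on a single bias-variance decomposition. If the mean \<open>z\<close> of
  \<open>\<phi> z s\<close> is itself drawn from \<open>\<phi> m w\<close>, then the best single guess for \<open>\<phi> z s\<close> in mean square is
  the mixture \<open>\<phi> m (w + s)\<close>, and the expected loss of any other guess \<open>h\<close> exceeds the optimum by
  exactly the integrated squared error between \<open>\<phi> m (w + s)\<close> and \<open>h\<close> (\<open>gauss_mixture_l2_loss\<close>).
  The decomposition is used twice.

  \<^item> The loss is translation invariant, so the risk of an equivariant estimator \<open>h (y - x)\<close> is the
    expected loss of the single guess \<open>h\<close> when the unknown mean \<open>\<mu> - X\<close> is drawn from \<open>\<phi> 0 v\<close>.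
    Hence \<open>h = \<phi> 0 (v + s)\<close> is optimal, and it is the only optimal choice up to null sets.

  \<^item> Under a prior \<open>\<phi> 0 \<tau>\<close> for \<open>\<mu>\<close>, the posterior given \<open>X = x\<close> is Gaussian with variance
    \<open>\<tau> v / (\<tau> + v)\<close>. The decomposition bounds the posterior expected loss of every estimator from
    below by a constant independent of \<open>x\<close>. As \<open>\<tau>\<close> tends to infinity this constant tends to the risk
    of the best equivariant estimator, which is therefore minimax.

  What remains is calculus. The risk of the \<open>N(X, t s)\<close> density is an increasing affine function
  of \<open>G t = (2 * t) powr - k - 2 * (r + t + 1) powr - k\<close> with \<open>k = p / 2\<close>. Its derivative is a
  positive multiple of \<open>(r + t + 1) powr - (k + 1) - (2 * t) powr - (k + 1)\<close> and has the sign of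
  \<open>2 * t - (r + t + 1)\<close>, so \<open>G\<close> decreases up to \<open>1 + r\<close>, increases afterwards, and
  stays below its limit \<open>0\<close> beyond the minimum. Consequently either \<open>G 1 \<ge> 0\<close>, which is the
  condition \<open>p \<ge> p\<^sub>0\<close>, and \<open>G\<close> is below \<open>G 1\<close> on all of \<open>t > 1\<close>; or \<open>G\<close> climbs back to the level
  \<open>G 1\<close> at exactly one point beyond the minimum.
\<close>

section \<open>Gaussian densities\<close>

lemma gauss_density_nonneg [simp]: "0 \<le> gauss_density m v y"
  by (simp add: gauss_density_def)

lemma gauss_density_pos: "v > 0 \<Longrightarrow> 0 < gauss_density m v y"
  by (simp add: gauss_density_def)

text \<open>
  The density depends only on the distance between mean and argument. Exchanging the two turns
  mixtures over means into ordinary Gaussian integrals.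
\<close>

lemma gauss_density_sym: "gauss_density m v y = gauss_density y v m"
  by (simp add: gauss_density_def norm_minus_commute)

lemma gauss_density_shift: "gauss_density m v y = gauss_density (m - a) v (y - a)"
  by (simp add: gauss_density_def)

text \<open>
  The values at the mean serve as the constants of the whole development: the squared \<open>L\<^sub>2\<close> norm
  of a Gaussian density of variance \<open>v\<close> is the central value of the density of variance \<open>2 * v\<close>.
\<close>

lemma gauss_density_center:
  "gauss_density (m::'a::euclidean_space) v m = 1 / (2 * pi * v) powr (real DIM('a) / 2)"
  by (simp add: gauss_density_def)

lemma gauss_density_measurable [measurable (raw)]:
  assumes [measurable]: "f \<in> borel_measurable M" "g \<in> borel_measurable M"
  shows "(\<lambda>x. gauss_density (f x :: 'a::euclidean_space) v (g x)) \<in> borel_measurable M"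
  unfolding gauss_density_def by measurable

lemma gauss_density_eq_prod_normal_density:
  fixes m :: "'a::euclidean_space"
  assumes "v > 0"
  shows "gauss_density m v y = (\<Prod>b\<in>Basis. normal_density (m \<bullet> b) (sqrt v) (y \<bullet> b))"
proof -
  have sq: "(norm (y - m))\<^sup>2 = (\<Sum>b\<in>Basis. (y \<bullet> b - m \<bullet> b)\<^sup>2)"
    unfolding power2_norm_eq_inner euclidean_inner[of "y - m" "y - m"]
    by (simp add: inner_diff_left power2_eq_square)
  have pw: "(1 / sqrt (2 * pi * v)) ^ DIM('a) = 1 / (2 * pi * v) powr (real DIM('a) / 2)"
    using assms
    by (simp add: power_divide powr_half_sqrt[symmetric] powr_powr flip: powr_realpow)
  have "(\<Prod>b\<in>Basis. normal_density (m \<bullet> b) (sqrt v) (y \<bullet> b)) =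
      (\<Prod>b\<in>(Basis::'a set). 1 / sqrt (2 * pi * v)) *
      exp (\<Sum>b\<in>Basis. - (y \<bullet> b - m \<bullet> b)\<^sup>2 / (2 * v))"
    using assms unfolding normal_density_def
    by (subst exp_sum) (simp_all add: prod_dividef power_divide)
  also have "(\<Sum>b\<in>Basis. - (y \<bullet> b - m \<bullet> b)\<^sup>2 / (2 * v)) = - (norm (y - m))\<^sup>2 / (2 * v)"
    by (simp add: sq sum_negf sum_divide_distrib)
  finally show ?thesis
    using pw by (simp add: gauss_density_def)
qed

lemma nn_integral_gauss_density:
  fixes m :: "'a::euclidean_space"
  assumes "v > 0"
  shows "(\<integral>\<^sup>+y. ennreal (gauss_density m v y) \<partial>lborel) = 1"
proof -
  have one: "(\<integral>\<^sup>+x. ennreal (normal_density a (sqrt v) x) \<partial>lborel) = 1" for a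
    using assms
    by (subst nn_integral_eq_integral)
       (simp_all add: integrable_normal_density integral_normal_density)
  have "(\<integral>\<^sup>+y. ennreal (gauss_density m v y) \<partial>lborel) =
      (\<integral>\<^sup>+y. (\<Prod>b\<in>Basis. ennreal (normal_density (m \<bullet> b) (sqrt v) (y \<bullet> b))) \<partial>lborel)"
    by (simp add: gauss_density_eq_prod_normal_density[OF assms] prod_ennreal)
  also have "\<dots> = 1"
    by (subst nn_integral_lborel_prod) (simp_all add: one)
  finally show ?thesis .
qed

lemma has_bochner_integral_gauss_density:
  fixes m :: "'a::euclidean_space"
  assumes "v > 0"
  shows "has_bochner_integral lborel (gauss_density m v) 1"
  by (rule has_bochner_integral_nn_integral) (simp_all add: nn_integral_gauss_density assms)

text \<open>
  Completing the square. Read with \<open>y\<close> as the parameter and \<open>b\<close> as the observation, this is Bayes'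
  rule for a Gaussian prior and a Gaussian likelihood: the first factor on the right is the
  marginal density of the observation, the second one is the posterior. Read as an identity to be integrated over \<open>y\<close>,
  it says that variances add under convolution.
\<close>

lemma gauss_density_mult:
  fixes a b y :: "'a::euclidean_space"
  assumes v: "v > 0" and w: "w > 0"
  shows "gauss_density a v y * gauss_density b w y =
    gauss_density a (v + w) b *
    gauss_density ((w / (v + w)) *\<^sub>R a + (v / (v + w)) *\<^sub>R b) (v * w / (v + w)) y"
proof -
  define k where "k = real DIM('a) / 2"
  define m where "m = (w / (v + w)) *\<^sub>R a + (v / (v + w)) *\<^sub>R b"
  define c d where "c = y - a" and "d = y - b"
  have s: "v + w > 0" using v w by simp
  have 1: "w / (v + w) + v / (v + w) = 1"
    using s by (simp add: add.commute flip: add_divide_distrib)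
  have "m - y = (w / (v + w)) *\<^sub>R a + (v / (v + w)) *\<^sub>R b - (w / (v + w) + v / (v + w)) *\<^sub>R y"
    by (simp only: 1 m_def) simp
  \<comment> \<open>The weights sum to one, so the distance to the weighted mean is the weighted mean of distances.\<close>
  hence ym: "y - m = (w / (v + w)) *\<^sub>R c + (v / (v + w)) *\<^sub>R d"
    by (simp add: c_def d_def algebra_simps)
  have ba: "b - a = c - d" by (simp add: c_def d_def)
  have n1: "(norm (y - m))\<^sup>2 =
      (w\<^sup>2 * (c \<bullet> c) + 2 * v * w * (c \<bullet> d) + v\<^sup>2 * (d \<bullet> d)) / (v + w)\<^sup>2"
  proof -
    have "(norm (y - m))\<^sup>2 = (w / (v + w))\<^sup>2 * (c \<bullet> c) +
        2 * (w / (v + w)) * (v / (v + w)) * (c \<bullet> d) + (v / (v + w))\<^sup>2 * (d \<bullet> d)"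
      unfolding ym power2_norm_eq_inner inner_add_left inner_add_right inner_scaleR_left
        inner_scaleR_right inner_commute[of d c]
      by algebra
    thus ?thesis
      by (simp add: power_divide add_divide_distrib power2_eq_square mult_ac)
  qed
  have n2: "(norm (b - a))\<^sup>2 = c \<bullet> c - 2 * (c \<bullet> d) + d \<bullet> d"
    unfolding ba power2_norm_eq_inner
    by (simp add: inner_diff_left inner_diff_right inner_commute[of d c])
  have e: "- (norm (y - a))\<^sup>2 / (2 * v) + - (norm (y - b))\<^sup>2 / (2 * w) =
      - (norm (b - a))\<^sup>2 / (2 * (v + w)) + - (norm (y - m))\<^sup>2 / (2 * (v * w / (v + w)))"
    unfolding n1 n2 c_def[symmetric] d_def[symmetric] power2_norm_eq_inner[of c]
      power2_norm_eq_inner[of d]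
    using v w s by (simp add: divide_simps) (simp add: algebra_simps power2_eq_square)
  have "(2 * pi * v) * (2 * pi * w) = (2 * pi * (v + w)) * (2 * pi * (v * w / (v + w)))"
    using s by simp
  hence pw: "(2 * pi * v) powr k * (2 * pi * w) powr k =
      (2 * pi * (v + w)) powr k * (2 * pi * (v * w / (v + w))) powr k"
    using v w s by (metis less_imp_le mult_pos_pos divide_pos_pos pi_gt_zero powr_mult zero_less_numeral)
  show ?thesis
    unfolding gauss_density_def m_def[symmetric] k_def[symmetric]
    by (simp only: times_divide_times_eq exp_add[symmetric] e pw)
qed

lemma gauss_density_square:
  fixes m :: "'a::euclidean_space"
  assumes "v > 0"
  shows "(gauss_density m v y)\<^sup>2 = gauss_density 0 (2 * v) (0::'a) * gauss_density m (v / 2) y"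
proof -
  have "(v / (v + v)) *\<^sub>R m + (v / (v + v)) *\<^sub>R m = m" "v * v / (v + v) = v / 2"
    using assms by (simp_all flip: scaleR_add_left add: field_simps)
  thus ?thesis
    using gauss_density_mult[OF assms assms, of m y m]
    by (simp add: power2_eq_square gauss_density_center)
qed

lemma has_bochner_integral_gauss_density_mult:
  fixes a b :: "'a::euclidean_space"
  assumes "v > 0" "w > 0"
  shows "has_bochner_integral lborel (\<lambda>y. gauss_density a v y * gauss_density b w y)
           (gauss_density a (v + w) b)"
proof -
  have "v * w / (v + w) > 0" using assms by simp
  from has_bochner_integral_mult_right[OF has_bochner_integral_gauss_density[OF this],
      where c = "gauss_density a (v + w) b"]
  show ?thesis by (simp add: gauss_density_mult[OF assms])
qed

lemma has_bochner_integral_gauss_density_square: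
  fixes m :: "'a::euclidean_space"
  assumes "v > 0"
  shows "has_bochner_integral lborel (\<lambda>y. (gauss_density m v y)\<^sup>2) (gauss_density 0 (2 * v) (0::'a))"
  using has_bochner_integral_gauss_density_mult[OF assms assms, of m m]
  by (simp add: power2_eq_square gauss_density_center)

lemma gauss_density_center_antimono:
  assumes "0 < v" "v \<le> w"
  shows "gauss_density 0 w (0::'a::euclidean_space) \<le> gauss_density 0 v (0::'a)"
  using assms unfolding gauss_density_center
  by (intro divide_left_mono powr_mono2) (auto intro!: mult_pos_pos)

section \<open>Integrated squared error and Gaussian mixtures\<close>

lemma has_bochner_integral_l2_gauss:
  fixes a b :: "'a::euclidean_space"
  assumes "v > 0" "w > 0"
  shows "has_bochner_integral lborel (\<lambda>y. (gauss_density a v y - gauss_density b w y)\<^sup>2)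
     (gauss_density 0 (2 * v) (0::'a) + gauss_density 0 (2 * w) (0::'a)
       - 2 * gauss_density a (v + w) b)"
proof -
  have "has_bochner_integral lborel
     (\<lambda>y. (gauss_density a v y)\<^sup>2 + (gauss_density b w y)\<^sup>2
         - 2 * (gauss_density a v y * gauss_density b w y))
     (gauss_density 0 (2 * v) (0::'a) + gauss_density 0 (2 * w) (0::'a)
       - 2 * gauss_density a (v + w) b)"
    by (intro has_bochner_integral_diff has_bochner_integral_add
        has_bochner_integral_mult_right has_bochner_integral_gauss_density_square
        has_bochner_integral_gauss_density_mult assms)
  thus ?thesis by (simp add: power2_diff algebra_simps)
qed

lemma l2_loss_gauss:
  fixes a b :: "'a::euclidean_space"
  assumes "v > 0" "w > 0"
  shows "l2_loss (gauss_density a v) (gauss_density b w) =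
     ennreal (gauss_density 0 (2 * v) (0::'a) + gauss_density 0 (2 * w) (0::'a)
       - 2 * gauss_density a (v + w) b)"
    and "0 \<le> gauss_density 0 (2 * v) (0::'a) + gauss_density 0 (2 * w) (0::'a)
       - 2 * gauss_density a (v + w) b"
proof -
  note int = has_bochner_integral_l2_gauss[OF assms, of a b]
  show "l2_loss (gauss_density a v) (gauss_density b w) =
     ennreal (gauss_density 0 (2 * v) (0::'a) + gauss_density 0 (2 * w) (0::'a)
       - 2 * gauss_density a (v + w) b)"
    using int unfolding l2_loss_def by (simp add: has_bochner_integral_iff nn_integral_eq_integral)
  have "0 \<le> (LINT y|lborel. (gauss_density a v y - gauss_density b w y)\<^sup>2)"
    by (intro Bochner_Integration.integral_nonneg) simp
  thus "0 \<le> gauss_density 0 (2 * v) (0::'a) + gauss_density 0 (2 * w) (0::'a)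
       - 2 * gauss_density a (v + w) b"
    using int by (simp only: has_bochner_integral_iff)
qed

lemma l2_loss_measurable:
  assumes [measurable]: "(\<lambda>(x, y). f x y) \<in> borel_measurable (M \<Otimes>\<^sub>M lborel)"
    "(\<lambda>(x, y). g x y) \<in> borel_measurable (M \<Otimes>\<^sub>M lborel)"
  shows "(\<lambda>x. l2_loss (f x) (g x)) \<in> borel_measurable M"
  unfolding l2_loss_def by measurable

text \<open>
  For a fixed \<open>y\<close>, consider the random number \<open>gauss_density z w y\<close> with \<open>z\<close> drawn from
  \<open>gauss_density m v\<close>. Its mean is \<open>gauss_density m (v + w) y\<close> and its variance is \<open>V\<close>, so this is
  the splitting of the mean squared error of a guess \<open>c\<close> into variance and squared bias.
\<close>

lemma gauss_mixture_pointwise: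
  fixes m y :: "'a::euclidean_space"
  assumes v: "v > 0" and w: "w > 0"
  defines "V \<equiv> gauss_density 0 (2 * w) (0::'a) * gauss_density m (v + w / 2) y
             - (gauss_density m (v + w) y)\<^sup>2"
  shows "(\<integral>\<^sup>+z. ennreal (gauss_density m v z * (gauss_density z w y - c)\<^sup>2) \<partial>lborel) =
           ennreal V + ennreal ((gauss_density m (v + w) y - c)\<^sup>2)"
    and "0 \<le> V"
proof -
  have int: "has_bochner_integral lborel (\<lambda>z. gauss_density m v z * (gauss_density z w y - c)\<^sup>2)
      (V + (gauss_density m (v + w) y - c)\<^sup>2)" for c
  proof -
    have "has_bochner_integral lborel
       (\<lambda>z. gauss_density 0 (2 * w) (0::'a) * (gauss_density m v z * gauss_density y (w / 2) z)
          - 2 * c * (gauss_density m v z * gauss_density y w z) + c\<^sup>2 * gauss_density m v z)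
       (gauss_density 0 (2 * w) (0::'a) * gauss_density m (v + w / 2) y
          - 2 * c * gauss_density m (v + w) y + c\<^sup>2 * 1)"
      by (intro has_bochner_integral_diff has_bochner_integral_add
          has_bochner_integral_mult_right has_bochner_integral_gauss_density
          has_bochner_integral_gauss_density_mult) (use v w in auto)
    moreover have "gauss_density 0 (2 * w) (0::'a) * (gauss_density m v z * gauss_density y (w / 2) z)
          - 2 * c * (gauss_density m v z * gauss_density y w z) + c\<^sup>2 * gauss_density m v z
        = gauss_density m v z * (gauss_density z w y - c)\<^sup>2" for z
      using gauss_density_square[OF w, of y z]
      by (simp add: gauss_density_sym[of z w y] power2_diff algebra_simps)
    moreover have "gauss_density 0 (2 * w) (0::'a) * gauss_density m (v + w / 2) y
          - 2 * c * gauss_density m (v + w) y + c\<^sup>2 * 1 = V + (gauss_density m (v + w) y - c)\<^sup>2"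
      by (simp add: V_def power2_diff algebra_simps)
    ultimately show ?thesis by simp
  qed
  \<comment> \<open>The guess \<open>c\<close> equal to the mean has no bias, so its mean squared error is the variance itself.\<close>
  show "0 \<le> V"
  proof -
    have "0 \<le> (LINT z|lborel. gauss_density m v z * (gauss_density z w y - gauss_density m (v + w) y)\<^sup>2)"
      by (intro Bochner_Integration.integral_nonneg) simp
    also have "\<dots> = V"
      using int[of "gauss_density m (v + w) y"] by (simp add: has_bochner_integral_iff)
    finally show ?thesis .
  qed
  thus "(\<integral>\<^sup>+z. ennreal (gauss_density m v z * (gauss_density z w y - c)\<^sup>2) \<partial>lborel) =
           ennreal V + ennreal ((gauss_density m (v + w) y - c)\<^sup>2)"
    using int[of c] by (simp add: has_bochner_integral_iff nn_integral_eq_integral ennreal_plus)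
qed

text \<open>
  Integration of the pointwise splitting over \<open>y\<close>. The first summand is the integrated variance
  and does not involve \<open>h\<close>, so the mixture density is the best \<open>h\<close> and the second summand is the
  exact price for deviating from it. Since \<open>h\<close> is an arbitrary measurable function, both sides
  may be infinite.
\<close>

lemma gauss_mixture_l2_loss:
  fixes m :: "'a::euclidean_space"
  assumes v: "v > 0" and w: "w > 0" and h [measurable]: "h \<in> borel_measurable borel"
  shows "(\<integral>\<^sup>+z. ennreal (gauss_density m v z) * l2_loss (gauss_density z w) h \<partial>lborel) =
           ennreal (gauss_density 0 (2 * w) (0::'a) - gauss_density 0 (2 * (v + w)) (0::'a)) +
           l2_loss (gauss_density m (v + w)) h"
proof -
  define V where "V y = gauss_density 0 (2 * w) (0::'a) * gauss_density m (v + w / 2) y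
             - (gauss_density m (v + w) y)\<^sup>2" for y
  have V [measurable]: "V \<in> borel_measurable borel" unfolding V_def by measurable
  have V0: "0 \<le> V y" for y unfolding V_def by (rule gauss_mixture_pointwise(2)[OF v w])
  have "has_bochner_integral lborel V
      (gauss_density 0 (2 * w) (0::'a) * 1 - gauss_density 0 (2 * (v + w)) (0::'a))"
    unfolding V_def
    by (intro has_bochner_integral_diff has_bochner_integral_mult_right
        has_bochner_integral_gauss_density has_bochner_integral_gauss_density_square)
       (use v w in auto)
  hence intV: "(\<integral>\<^sup>+y. ennreal (V y) \<partial>lborel) =
      ennreal (gauss_density 0 (2 * w) (0::'a) - gauss_density 0 (2 * (v + w)) (0::'a))"
    using V0 by (simp add: has_bochner_integral_iff nn_integral_eq_integral)
  have "(\<integral>\<^sup>+z. ennreal (gauss_density m v z) * l2_loss (gauss_density z w) h \<partial>lborel) =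
     (\<integral>\<^sup>+z. (\<integral>\<^sup>+y. ennreal (gauss_density m v z * (gauss_density z w y - h y)\<^sup>2) \<partial>lborel) \<partial>lborel)"
    unfolding l2_loss_def by (simp add: ennreal_mult nn_integral_cmult)
  also have "\<dots> =
     (\<integral>\<^sup>+y. (\<integral>\<^sup>+z. ennreal (gauss_density m v z * (gauss_density z w y - h y)\<^sup>2) \<partial>lborel) \<partial>lborel)"
    by (rule lborel_pair.Fubini'[symmetric]) measurable
  also have "\<dots> = (\<integral>\<^sup>+y. ennreal (V y) + ennreal ((gauss_density m (v + w) y - h y)\<^sup>2) \<partial>lborel)"
    by (simp add: gauss_mixture_pointwise(1)[OF v w] V_def)
  also have "\<dots> = ennreal (gauss_density 0 (2 * w) (0::'a) - gauss_density 0 (2 * (v + w)) (0::'a)) +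
           l2_loss (gauss_density m (v + w)) h"
    unfolding l2_loss_def by (subst nn_integral_add) (simp_all add: intV)
  finally show ?thesis .
qed

section \<open>Translations\<close>

lemma nn_integral_lborel_plus:
  fixes f :: "'a::euclidean_space \<Rightarrow> ennreal"
  assumes [measurable]: "f \<in> borel_measurable borel"
  shows "(\<integral>\<^sup>+x. f (c + x) \<partial>lborel) = (\<integral>\<^sup>+x. f x \<partial>lborel)"
  by (subst (2) lborel_distr_plus[of c, symmetric]) (simp add: nn_integral_distr)

lemma nn_integral_lborel_reflect:
  fixes f :: "'a::euclidean_space \<Rightarrow> ennreal"
  assumes [measurable]: "f \<in> borel_measurable borel"
  shows "(\<integral>\<^sup>+x. f (c - x) \<partial>lborel) = (\<integral>\<^sup>+x. f x \<partial>lborel)"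
proof -
  have "lborel = distr lborel borel (\<lambda>x::'a. c - x)"
    by (subst lborel_affine[of "-1" c]) (simp_all add: density_1)
  hence "(\<integral>\<^sup>+x. f x \<partial>lborel) = (\<integral>\<^sup>+x. f x \<partial>distr lborel borel (\<lambda>x::'a. c - x))"
    by simp
  thus ?thesis by (simp add: nn_integral_distr)
qed

lemma l2_loss_translate:
  fixes f g :: "'a::euclidean_space \<Rightarrow> real"
  assumes [measurable]: "f \<in> borel_measurable borel" "g \<in> borel_measurable borel"
  shows "l2_loss (\<lambda>y. f (y - a)) (\<lambda>y. g (y - a)) = l2_loss f g"
  using nn_integral_lborel_plus[of "\<lambda>y. ennreal ((f y - g y)\<^sup>2)" "- a"]
  unfolding l2_loss_def by simp

lemma l2_loss_eq_0_iff_AE: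
  fixes f g :: "'a::euclidean_space \<Rightarrow> real"
  assumes [measurable]: "f \<in> borel_measurable borel" "g \<in> borel_measurable borel"
  shows "l2_loss f g = 0 \<longleftrightarrow> (AE y in lborel. f y = g y)"
  unfolding l2_loss_def by (subst nn_integral_0_iff_AE) simp_all

lemma AE_lborel_translate:
  fixes P :: "'a::euclidean_space \<Rightarrow> bool"
  assumes [measurable]: "Measurable.pred borel P" and "AE y in lborel. P y"
  shows "AE y in lborel. P (y - a)"
proof -
  have "AE y in distr lborel borel ((+) (- a)). P y"
    unfolding lborel_distr_plus by (rule assms(2))
  thus ?thesis by (subst (asm) AE_distr_iff) simp_all
qed

section \<open>Equivariant and minimax estimators\<close>

text \<open>
  The risk in terms of the distribution of the observation alone: \<open>X\<close> has variance \<open>v\<close>, and the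
  density to be estimated has variance \<open>w\<close>. For a jointly measurable \<open>Q\<close> this expression is measurable
  in \<open>\<mu>\<close>, whereas a family \<open>M \<mu>\<close> of probability measures may depend on \<open>\<mu>\<close> arbitrarily; averaging
  over a prior requires such measurability.
\<close>

definition gauss_model_risk ::
    "real \<Rightarrow> real \<Rightarrow> 'a::euclidean_space \<Rightarrow> ('a \<Rightarrow> 'a \<Rightarrow> real) \<Rightarrow> ennreal" where
  "gauss_model_risk v w \<mu> Q =
     (\<integral>\<^sup>+x. ennreal (gauss_density \<mu> v x) * l2_loss (gauss_density \<mu> w) (\<lambda>y. Q y x) \<partial>lborel)"

lemma density_estimator_measurable:
  assumes "density_estimator Q"
  shows "(\<lambda>(x, y). Q y x) \<in> borel_measurable (lborel \<Otimes>\<^sub>M lborel)"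
proof -
  have [measurable]: "(\<lambda>(y, x). Q y x) \<in> borel_measurable (borel \<Otimes>\<^sub>M borel)"
    using assms by (simp add: density_estimator_def borel_prod)
  have "(\<lambda>z. (\<lambda>(y, x). Q y x) (snd z, fst z)) \<in> borel_measurable (borel \<Otimes>\<^sub>M borel)"
    by measurable
  thus ?thesis by (simp add: case_prod_beta cong: measurable_cong_sets)
qed

lemma gauss_estimator_density_estimator:
  assumes "t > 0" and [measurable]: "d \<in> borel_measurable borel"
  shows "density_estimator (gauss_estimator t d)"
  unfolding density_estimator_def gauss_estimator_def borel_prod[symmetric]
  by (auto simp: nn_integral_gauss_density assms)

text \<open>
  Stated for jointly measurable kernels, as the transfer from the sample space to the
  distribution of \<open>X\<close> requires the loss to be a measurable function of the observation.
\<close>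

lemma density_risk_eq_gauss_model_risk:
  fixes M :: "'a::euclidean_space \<Rightarrow> 'w measure"
  assumes X: "distributed (M \<mu>) lborel X (\<lambda>x. ennreal (gauss_density \<mu> v x))"
    and Q: "(\<lambda>(x, y). Q y x) \<in> borel_measurable (lborel \<Otimes>\<^sub>M lborel)"
  shows "density_risk M X (gauss_density 0 w) \<mu> Q = gauss_model_risk v w \<mu> Q"
proof -
  have [measurable]: "(\<lambda>x. l2_loss (gauss_density \<mu> w) (\<lambda>y. Q y x)) \<in> borel_measurable lborel"
    by (rule l2_loss_measurable[OF _ Q]) measurable
  have "(\<lambda>y. gauss_density 0 w (y - \<mu>)) = gauss_density \<mu> w"
    by (simp add: gauss_density_shift[of \<mu> w _ \<mu>] fun_eq_iff)
  thus ?thesis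
    unfolding density_risk_def gauss_model_risk_def
    by (simp add: distributed_nn_integral[OF X])
qed

text \<open>
  Shifting by the observation turns the target \<open>gauss_density \<mu> w\<close> into
  \<open>gauss_density (\<mu> - x) w\<close> and the estimate into the fixed function \<open>\<lambda>u. Q u 0\<close>. As
  \<open>\<mu> - X\<close> has density \<open>gauss_density 0 v\<close> for every \<open>\<mu>\<close>, the risk is constant and given by the
  mixture decomposition.
\<close>

lemma gauss_model_risk_equivariant:
  fixes Q :: "'a::euclidean_space \<Rightarrow> 'a \<Rightarrow> real"
  assumes v: "v > 0" and w: "w > 0" and eq: "equivariant Q"
    and Q [measurable]: "(\<lambda>(x, y). Q y x) \<in> borel_measurable (lborel \<Otimes>\<^sub>M lborel)"
  shows "gauss_model_risk v w \<mu> Q =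
    ennreal (gauss_density 0 (2 * w) (0::'a) - gauss_density 0 (2 * (v + w)) (0::'a)) +
    l2_loss (gauss_density 0 (v + w)) (\<lambda>u. Q u 0)"
proof -
  have "(\<lambda>u. (\<lambda>(x, y). Q y x) (0, u)) \<in> borel_measurable lborel" by measurable
  hence h [measurable]: "(\<lambda>u. Q u 0) \<in> borel_measurable borel" by simp
  have loss: "l2_loss (gauss_density \<mu> w) (\<lambda>y. Q y x) =
      l2_loss (gauss_density (\<mu> - x) w) (\<lambda>u. Q u 0)" for x
  proof -
    have "(\<lambda>y. Q y x) = (\<lambda>y. Q (y - x) 0)"
      using eq unfolding equivariant_def by blast
    moreover have "gauss_density \<mu> w = (\<lambda>y. gauss_density (\<mu> - x) w (y - x))"
      using gauss_density_shift[of \<mu> w _ x] by blast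
    ultimately show ?thesis
      using l2_loss_translate[of "gauss_density (\<mu> - x) w" "\<lambda>u. Q u 0" x] by simp
  qed
  have [measurable]: "(\<lambda>z. l2_loss (gauss_density z w) (\<lambda>u. Q u 0)) \<in> borel_measurable borel"
    by (rule l2_loss_measurable) measurable
  have "gauss_model_risk v w \<mu> Q = (\<integral>\<^sup>+x. ennreal (gauss_density 0 v (\<mu> - x)) *
      l2_loss (gauss_density (\<mu> - x) w) (\<lambda>u. Q u 0) \<partial>lborel)"
    unfolding gauss_model_risk_def
    by (simp add: loss gauss_density_def norm_minus_commute)
  also have "\<dots> = (\<integral>\<^sup>+z. ennreal (gauss_density 0 v z) *
      l2_loss (gauss_density z w) (\<lambda>u. Q u 0) \<partial>lborel)"
    by (rule nn_integral_lborel_reflect) measurable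
  also have "\<dots> =
    ennreal (gauss_density 0 (2 * w) (0::'a) - gauss_density 0 (2 * (v + w)) (0::'a)) +
    l2_loss (gauss_density 0 (v + w)) (\<lambda>u. Q u 0)"
    by (rule gauss_mixture_l2_loss[OF v w h])
  finally show ?thesis .
qed

text \<open>
  A supremum is at least an average, here over the prior \<open>gauss_density 0 \<tau>\<close>. After
  exchanging the integrals, the inner one is the posterior expected loss given \<open>x\<close>. The
  posterior variance does not depend on \<open>x\<close>, hence neither does the integrated variance
  that bounds the posterior expected loss from below.
\<close>

lemma bayes_risk_lower_bound:
  fixes Q :: "'a::euclidean_space \<Rightarrow> 'a \<Rightarrow> real"
  assumes v: "v > 0" and w: "w > 0" and \<tau>: "\<tau> > 0"
    and Q [measurable]: "(\<lambda>(x, y). Q y x) \<in> borel_measurable (lborel \<Otimes>\<^sub>M lborel)"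
  shows "ennreal (gauss_density 0 (2 * w) (0::'a) - gauss_density 0 (2 * (\<tau> * v / (\<tau> + v) + w)) (0::'a))
    \<le> (SUP \<mu>. gauss_model_risk v w \<mu> Q)"
proof -
  define s where "s = \<tau> * v / (\<tau> + v)"
  have s: "s > 0" unfolding s_def using v \<tau> by simp
  define \<rho> where "\<rho> = gauss_density 0 (2 * w) (0::'a) - gauss_density 0 (2 * (s + w)) (0::'a)"
  define c where "c x = (\<tau> / (\<tau> + v)) *\<^sub>R x" for x :: 'a
  \<comment> \<open>Prior times likelihood is marginal times posterior.\<close>
  have post: "gauss_density 0 \<tau> \<mu> * gauss_density \<mu> v x =
      gauss_density 0 (\<tau> + v) x * gauss_density (c x) s \<mu>" for \<mu> x :: 'a
    using gauss_density_mult[OF \<tau> v, of 0 \<mu> x]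
    by (simp add: gauss_density_sym[of \<mu> v x] s_def c_def)
  have Qx: "(\<lambda>y. Q y x) \<in> borel_measurable borel" for x
  proof -
    have "(\<lambda>y. (\<lambda>(x, y). Q y x) (x, y)) \<in> borel_measurable lborel" by measurable
    thus ?thesis by simp
  qed
  have [measurable]: "(\<lambda>(\<mu>, x). l2_loss (gauss_density \<mu> w) (\<lambda>y. Q y x))
      \<in> borel_measurable (lborel \<Otimes>\<^sub>M lborel)"
    unfolding l2_loss_def by measurable
  have "ennreal \<rho> = (\<integral>\<^sup>+x. ennreal (gauss_density 0 (\<tau> + v) x) * ennreal \<rho> \<partial>(lborel :: 'a measure))"
    using v \<tau> by (simp add: nn_integral_multc nn_integral_gauss_density)
  also have "\<dots> \<le> (\<integral>\<^sup>+x. ennreal (gauss_density 0 (\<tau> + v) x) *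
      (\<integral>\<^sup>+\<mu>. ennreal (gauss_density (c x) s \<mu>) *
         l2_loss (gauss_density \<mu> w) (\<lambda>y. Q y x) \<partial>lborel) \<partial>lborel)"
    unfolding gauss_mixture_l2_loss[OF s w Qx] \<rho>_def
    by (intro nn_integral_mono mult_left_mono) simp_all
  also have "\<dots> = (\<integral>\<^sup>+x. (\<integral>\<^sup>+\<mu>. ennreal (gauss_density 0 \<tau> \<mu>) * (ennreal (gauss_density \<mu> v x) *
         l2_loss (gauss_density \<mu> w) (\<lambda>y. Q y x)) \<partial>lborel) \<partial>lborel)"
    by (simp add: nn_integral_cmult[symmetric] mult.assoc[symmetric] ennreal_mult[symmetric] post)
  also have "\<dots> = (\<integral>\<^sup>+\<mu>. (\<integral>\<^sup>+x. ennreal (gauss_density 0 \<tau> \<mu>) * (ennreal (gauss_density \<mu> v x) *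
         l2_loss (gauss_density \<mu> w) (\<lambda>y. Q y x)) \<partial>lborel) \<partial>lborel)"
    by (rule lborel_pair.Fubini') measurable
  also have "\<dots> = (\<integral>\<^sup>+\<mu>. ennreal (gauss_density 0 \<tau> \<mu>) * gauss_model_risk v w \<mu> Q \<partial>lborel)"
    unfolding gauss_model_risk_def by (simp add: nn_integral_cmult)
  also have "\<dots> \<le> (\<integral>\<^sup>+\<mu>. ennreal (gauss_density (0::'a) \<tau> \<mu>) * (SUP \<mu>. gauss_model_risk v w \<mu> Q) \<partial>lborel)"
    by (intro nn_integral_mono mult_left_mono SUP_upper) simp_all
  also have "\<dots> = (SUP \<mu>. gauss_model_risk v w \<mu> Q)"
    using \<tau> by (simp add: nn_integral_multc nn_integral_gauss_density)
  finally show ?thesis by (simp add: \<rho>_def s_def)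
qed

text \<open>
  The limit of ever flatter priors: the posterior variance \<open>\<tau> * v / (\<tau> + v)\<close> increases to \<open>v\<close>.
\<close>

lemma minimax_risk_lower_bound:
  fixes Q :: "'a::euclidean_space \<Rightarrow> 'a \<Rightarrow> real"
  assumes v: "v > 0" and w: "w > 0"
    and Q: "(\<lambda>(x, y). Q y x) \<in> borel_measurable (lborel \<Otimes>\<^sub>M lborel)"
  shows "ennreal (gauss_density 0 (2 * w) (0::'a) - gauss_density 0 (2 * (v + w)) (0::'a))
    \<le> (SUP \<mu>. gauss_model_risk v w \<mu> Q)"
proof (rule tendsto_upperbound)
  have "((\<lambda>\<tau>. \<tau> * v / (\<tau> + v)) \<longlongrightarrow> v) at_top"
    using v by real_asymp
  hence "((\<lambda>\<tau>. 1 / (2 * pi * (2 * (\<tau> * v / (\<tau> + v) + w))) powr (real DIM('a) / 2)) \<longlongrightarrow>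
      1 / (2 * pi * (2 * (v + w))) powr (real DIM('a) / 2)) at_top"
    using v w by (intro tendsto_intros) auto
  thus "((\<lambda>\<tau>. ennreal (gauss_density 0 (2 * w) (0::'a)
        - gauss_density 0 (2 * (\<tau> * v / (\<tau> + v) + w)) (0::'a)))
      \<longlongrightarrow> ennreal (gauss_density 0 (2 * w) (0::'a) - gauss_density 0 (2 * (v + w)) (0::'a))) at_top"
    unfolding gauss_density_center by (intro tendsto_ennrealI tendsto_diff tendsto_const)
  show "\<forall>\<^sub>F \<tau> in at_top. ennreal (gauss_density 0 (2 * w) (0::'a)
        - gauss_density 0 (2 * (\<tau> * v / (\<tau> + v) + w)) (0::'a)) \<le> (SUP \<mu>. gauss_model_risk v w \<mu> Q)"
    using eventually_gt_at_top[of "0::real"]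
    by eventually_elim (rule bayes_risk_lower_bound[OF v w _ Q])
qed simp

lemma equivariant_gauss_estimator: "equivariant (gauss_estimator w (\<lambda>x. x))"
  unfolding equivariant_def gauss_estimator_def
  by (metis gauss_density_shift diff_self)

text \<open>
  By the decomposition of equivariant risks, an equivariant estimator is optimal iff its excess
  loss vanishes, which determines it up to null sets. Its constant risk is the lower bound
  obtained from flat priors, so it is minimax.
\<close>

lemma gauss_min_risk_equivariant:
  fixes R :: "'a::euclidean_space \<Rightarrow> ('a \<Rightarrow> 'a \<Rightarrow> real) \<Rightarrow> ennreal"
  assumes v: "v > 0" and s: "s > 0"
    and R: "\<And>\<mu> Q. density_estimator Q \<Longrightarrow> R \<mu> Q = gauss_model_risk v s \<mu> Q"
  defines "\<rho> \<equiv> gauss_density 0 (2 * s) (0::'a) - gauss_density 0 (2 * (v + s)) (0::'a)"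
  shows "min_risk_equivariant R (gauss_estimator (v + s) (\<lambda>x. x))"
    and "min_risk_equivariant R Q \<Longrightarrow> R \<mu> Q = ennreal \<rho>"
    and "min_risk_equivariant R Q \<Longrightarrow> AE y in lborel. Q y x = gauss_density x (v + s) y"
    and "min_risk_equivariant R Q \<Longrightarrow> minimax R Q"
proof -
  let ?g = "gauss_estimator (v + s) (\<lambda>x::'a. x)"
  have de: "density_estimator ?g"
    using v s by (intro gauss_estimator_density_estimator) auto
  have risk: "R \<mu> Q = ennreal \<rho> + l2_loss (gauss_density 0 (v + s)) (\<lambda>u. Q u 0)"
    if "density_estimator Q" "equivariant Q" for \<mu> Q
    using gauss_model_risk_equivariant[OF v s that(2) density_estimator_measurable[OF that(1)]]
      R[OF that(1)] by (simp add: \<rho>_def)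
  have risk_g: "R \<mu> ?g = ennreal \<rho>" for \<mu>
    using risk[OF de equivariant_gauss_estimator] by (simp add: gauss_estimator_def l2_loss_def)
  show mre: "min_risk_equivariant R ?g"
    unfolding min_risk_equivariant_def
    by (auto simp: de equivariant_gauss_estimator risk_g risk)
  assume Q: "min_risk_equivariant R Q"
  hence dQ: "density_estimator Q" and eQ: "equivariant Q" by (simp_all add: min_risk_equivariant_def)
  show risk_Q: "R \<mu> Q = ennreal \<rho>" for \<mu>
    using Q mre risk_g unfolding min_risk_equivariant_def by (metis order_antisym)
  have zero: "l2_loss (gauss_density 0 (v + s)) (\<lambda>u. Q u 0) = 0"
  proof -
    have "ennreal \<rho> + l2_loss (gauss_density 0 (v + s)) (\<lambda>u. Q u 0) = ennreal \<rho> + 0"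
      using risk_Q[of 0] risk[OF dQ eQ, of 0] by simp
    thus ?thesis by (simp add: ennreal_add_left_cancel)
  qed
  have "(\<lambda>u. (\<lambda>(x, y). Q y x) (0, u)) \<in> borel_measurable lborel"
    using density_estimator_measurable[OF dQ] by measurable
  hence h [measurable]: "(\<lambda>u. Q u 0) \<in> borel_measurable borel" by simp
  have "AE u in lborel. gauss_density 0 (v + s) u = Q u 0"
    using zero by (simp add: l2_loss_eq_0_iff_AE)
  hence "AE y in lborel. gauss_density 0 (v + s) (y - x) = Q (y - x) 0"
    by (intro AE_lborel_translate[where P = "\<lambda>u. gauss_density 0 (v + s) u = Q u 0"]) measurable
  moreover have "Q (y - x) 0 = Q y x" for y
    using eQ unfolding equivariant_def by metis
  moreover have "gauss_density 0 (v + s) (y - x) = gauss_density x (v + s) y" for y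
    by (simp add: gauss_density_shift[of x "v + s" y x])
  ultimately show "AE y in lborel. Q y x = gauss_density x (v + s) y"
    by (simp add: eq_commute)
  show "minimax R Q"
    unfolding minimax_def
    using minimax_risk_lower_bound[OF v s density_estimator_measurable]
    by (auto simp: dQ risk_Q R \<rho>_def)
qed

section \<open>Point estimation under reflected normal loss\<close>

lemma reflected_normal_loss_bounds:
  assumes "\<gamma> > 0"
  shows "0 \<le> reflected_normal_loss \<gamma> \<mu> m" "reflected_normal_loss \<gamma> \<mu> m \<le> 1"
  using assms by (simp_all add: reflected_normal_loss_def)

lemma gauss_density_eq_reflected_normal_loss:
  "gauss_density \<mu> \<gamma> m =
     gauss_density 0 \<gamma> (0::'a::euclidean_space) * (1 - reflected_normal_loss \<gamma> \<mu> (m::'a))"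
  by (simp add: gauss_density_def reflected_normal_loss_def)

lemma integrable_reflected_normal_loss:
  fixes f :: "'w \<Rightarrow> 'a::euclidean_space"
  assumes "prob_space M" and \<gamma>: "\<gamma> > 0" and [measurable]: "f \<in> borel_measurable M"
  shows "integrable M (\<lambda>\<omega>. reflected_normal_loss \<gamma> \<mu> (f \<omega>))"
proof -
  interpret prob_space M by fact
  show ?thesis
  proof (rule integrable_const_bound[where B = 1])
    show "(\<lambda>\<omega>. reflected_normal_loss \<gamma> \<mu> (f \<omega>)) \<in> borel_measurable M"
      unfolding reflected_normal_loss_def by measurable
  qed (simp add: abs_le_iff reflected_normal_loss_bounds[OF \<gamma>] minus_le_iff
        order.trans[OF _ reflected_normal_loss_bounds(1)[OF \<gamma>]])
qed

lemma point_risk_affine: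
  fixes X :: "'w \<Rightarrow> 'a::euclidean_space"
  assumes P: "prob_space (M \<mu>)" and X: "X \<in> borel_measurable (M \<mu>)" and \<gamma>: "\<gamma> > 0"
    and d [measurable]: "d \<in> borel_measurable borel"
  shows "point_risk M X (\<lambda>\<mu> m. a + b * reflected_normal_loss \<gamma> \<mu> m) \<mu> d =
           a + b * point_risk M X (reflected_normal_loss \<gamma>) \<mu> d"
proof -
  interpret prob_space "M \<mu>" by fact
  note [measurable] = X
  show ?thesis
    unfolding point_risk_def
    by (simp add: integrable_reflected_normal_loss[OF P \<gamma>] prob_space)
qed

text \<open>
  The cross term of the squared error is a Gaussian density of variance \<open>v + w\<close>, which equals its
  central value times \<open>1 - reflected_normal_loss\<close>. The point loss is therefore \<open>a - b\<close> plus
  \<open>b\<close> times the reflected normal loss. The nonnegativity statement lets comparisons of extended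
  nonnegative risks be read off from the real ones.
\<close>

lemma density_risk_gauss_estimator:
  fixes X :: "'w \<Rightarrow> 'a::euclidean_space"
  assumes P: "prob_space (M \<mu>)" and X: "X \<in> borel_measurable (M \<mu>)"
    and v: "v > 0" and w: "w > 0" and d [measurable]: "d \<in> borel_measurable borel"
  defines "b \<equiv> 2 * gauss_density 0 (v + w) (0::'a)"
  defines "a \<equiv> gauss_density 0 (2 * v) (0::'a) + gauss_density 0 (2 * w) (0::'a)"
  shows "density_risk M X (gauss_density 0 v) \<mu> (gauss_estimator w d) =
     ennreal (point_risk M X (\<lambda>\<mu> m. (a - b) + b * reflected_normal_loss (v + w) \<mu> m) \<mu> d)"
    and "0 \<le> point_risk M X (\<lambda>\<mu> m. (a - b) + b * reflected_normal_loss (v + w) \<mu> m) \<mu> d"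
proof -
  interpret prob_space "M \<mu>" by fact
  note [measurable] = X
  let ?l = "\<lambda>m. (a - b) + b * reflected_normal_loss (v + w) \<mu> m"
  have eq: "gauss_density 0 (2 * v) (0::'a) + gauss_density 0 (2 * w) (0::'a)
       - 2 * gauss_density \<mu> (v + w) m = ?l m" for m
    unfolding gauss_density_eq_reflected_normal_loss[of \<mu> "v + w" m] a_def b_def
    by (simp add: algebra_simps)
  have "(\<lambda>y. gauss_density 0 v (y - \<mu>)) = gauss_density \<mu> v"
    by (simp add: gauss_density_shift[of \<mu> v _ \<mu>] fun_eq_iff)
  hence loss: "l2_loss (\<lambda>y. gauss_density 0 v (y - \<mu>)) (gauss_density m w) = ennreal (?l m)" for m
    using l2_loss_gauss(1)[OF v w, of \<mu> m] by (simp only: eq)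
  have nn: "0 \<le> ?l m" for m
    using l2_loss_gauss(2)[OF v w, of \<mu> m] by (simp only: eq)
  have int: "integrable (M \<mu>) (\<lambda>\<omega>. ?l (d (X \<omega>)))"
    using v w by (intro Bochner_Integration.integrable_add integrable_mult_right
        integrable_reflected_normal_loss[OF P]) simp_all
  show "density_risk M X (gauss_density 0 v) \<mu> (gauss_estimator w d) =
     ennreal (point_risk M X (\<lambda>\<mu> m. (a - b) + b * reflected_normal_loss (v + w) \<mu> m) \<mu> d)"
    unfolding density_risk_def gauss_estimator_def point_risk_def loss
    by (rule nn_integral_eq_integral[OF int]) (simp add: nn)
  show "0 \<le> point_risk M X (\<lambda>\<mu> m. (a - b) + b * reflected_normal_loss (v + w) \<mu> m) \<mu> d"
    unfolding point_risk_def by (intro Bochner_Integration.integral_nonneg) (simp add: nn)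
qed

section \<open>The risk as a function of the variance ratio\<close>

text \<open>
  The part of the risk of the \<open>N(X, t s)\<close> density that varies with \<open>t\<close>, in units of
  \<open>(2 * pi * s) powr - k\<close>, where \<open>r\<close> is the ratio of the variances of \<open>X\<close> and \<open>Y\<close> and \<open>k\<close> is
  half the dimension.
\<close>

definition risk_profile :: "real \<Rightarrow> real \<Rightarrow> real \<Rightarrow> real" where
  "risk_profile k r t = 1 / (2 * t) powr k - 2 / (r + t + 1) powr k"

lemma risk_profile_deriv:
  assumes "t > 0" "r > 0"
  shows "(risk_profile k r has_real_derivative
           2 * k * ((r + t + 1) powr (- k - 1) - (2 * t) powr (- k - 1))) (at t)"
proof -
  have "((\<lambda>t. (2 * t) powr (- k) - 2 * (r + t + 1) powr (- k)) has_real_derivative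
           2 * k * ((r + t + 1) powr (- k - 1) - (2 * t) powr (- k - 1))) (at t)"
    using assms by (auto intro!: derivative_eq_intros simp: algebra_simps)
  moreover have "risk_profile k r = (\<lambda>t. (2 * t) powr (- k) - 2 * (r + t + 1) powr (- k))"
    by (simp add: risk_profile_def powr_minus_divide fun_eq_iff)
  ultimately show ?thesis by simp
qed

lemma risk_profile_continuous:
  assumes "a > 0" "r > 0"
  shows "continuous_on {a..b} (risk_profile k r)"
  using assms
  by (auto intro!: continuous_at_imp_continuous_on DERIV_isCont[OF risk_profile_deriv])

text \<open>
  Below \<open>1 + r\<close> the inequality \<open>2 * x < r + x + 1\<close> holds, and a negative power reverses it. The
  derivative vanishes at \<open>1 + r\<close> itself, so only its sign on the open interval is used.
\<close>

lemma risk_profile_decreasing: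
  assumes k: "k > 0" and r: "r > 0" and st: "0 < s" "s < t" "t \<le> 1 + r"
  shows "risk_profile k r t < risk_profile k r s"
proof (rule DERIV_neg_imp_decreasing_open[OF st(2)])
  fix x assume x: "s < x" "x < t"
  have "(r + x + 1) powr (- k - 1) < (2 * x) powr (- k - 1)"
    using k st x by (intro powr_less_mono2_neg) auto
  hence "2 * k * ((r + x + 1) powr (- k - 1) - (2 * x) powr (- k - 1)) < 0"
    using k by (simp add: mult_less_0_iff)
  thus "\<exists>y. (risk_profile k r has_real_derivative y) (at x) \<and> y < 0"
    using risk_profile_deriv[of x r k] r st x by fastforce
qed (rule risk_profile_continuous[OF st(1) r])

lemma risk_profile_increasing:
  assumes k: "k > 0" and r: "r > 0" and st: "1 + r \<le> s" "s < t"
  shows "risk_profile k r s < risk_profile k r t"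
proof (rule DERIV_pos_imp_increasing_open[OF st(2)])
  fix x assume x: "s < x" "x < t"
  have "(2 * x) powr (- k - 1) < (r + x + 1) powr (- k - 1)"
    using k r st x by (intro powr_less_mono2_neg) auto
  hence "2 * k * ((r + x + 1) powr (- k - 1) - (2 * x) powr (- k - 1)) > 0"
    using k by simp
  thus "\<exists>y. (risk_profile k r has_real_derivative y) (at x) \<and> y > 0"
    using risk_profile_deriv[of x r k] r st x by fastforce
qed (rule risk_profile_continuous, use r st in auto)

lemma risk_profile_minimum:
  assumes "k > 0" "r > 0" "t > 0" "t \<noteq> 1 + r"
  shows "risk_profile k r (1 + r) < risk_profile k r t"
  using risk_profile_decreasing[of k r t "1 + r"] risk_profile_increasing[of k r "1 + r" t] assms
  by (cases "t < 1 + r") auto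

text \<open>
  From the minimum on, \<open>r + t + 1 \<le> 2 * t\<close>, so half of the subtracted term is already at least as
  large as the other one.
\<close>

lemma risk_profile_neg:
  assumes k: "k > 0" and r: "r > 0" and t: "t \<ge> 1 + r"
  shows "risk_profile k r t < 0"
proof -
  have "(r + t + 1) powr k \<le> (2 * t) powr k"
    using assms by (intro powr_mono2) auto
  hence "1 / (2 * t) powr k \<le> 1 / (r + t + 1) powr k"
    using assms by (intro divide_left_mono) auto
  also have "\<dots> < 2 / (r + t + 1) powr k"
    using assms by (intro divide_strict_right_mono) auto
  finally show ?thesis by (simp add: risk_profile_def)
qed

text \<open>
  Dividing by \<open>2 powr - k\<close>, the sign of the profile at \<open>1\<close> is that of
  \<open>1 - 2 * (1 + r / 2) powr - k\<close>. Taking logarithms yields the critical dimension.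
\<close>

lemma risk_profile_1_nonneg_iff:
  assumes r: "r > 0"
  shows "0 \<le> risk_profile (p / 2) r 1 \<longleftrightarrow> ln 4 / ln (1 + r / 2) \<le> p"
proof -
  define k where "k = p / 2"
  have split: "(r + 2) powr k = 2 powr k * (1 + r / 2) powr k"
    using r by (simp add: algebra_simps flip: powr_mult)
  have "0 \<le> risk_profile k r 1 \<longleftrightarrow> 2 / (r + 2) powr k \<le> 1 / 2 powr k"
    by (simp add: risk_profile_def add.assoc)
  also have "\<dots> \<longleftrightarrow> 2 \<le> (1 + r / 2) powr k"
    using r unfolding split by (simp add: field_simps)
  also have "\<dots> \<longleftrightarrow> ln 2 \<le> ln ((1 + r / 2) powr k)"
    using r by (subst ln_le_cancel_iff) auto
  also have "\<dots> \<longleftrightarrow> 2 * ln 2 \<le> p * ln (1 + r / 2)"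
    using r by (simp add: ln_powr k_def mult.commute)
  also have "2 * ln 2 = ln (4::real)"
    using ln_realpow[of "2::real" 2] by simp
  also have "ln 4 \<le> p * ln (1 + r / 2) \<longleftrightarrow> ln 4 / ln (1 + r / 2) \<le> p"
    using r by (simp add: pos_divide_le_eq)
  finally show ?thesis by (simp add: k_def)
qed

text \<open>
  Up to the minimum the profile decreases from its value at \<open>1\<close>; beyond the minimum it is
  negative.
\<close>

lemma risk_profile_below_1:
  assumes k: "k > 0" and r: "r > 0" and G: "0 \<le> risk_profile k r 1" and t: "t > 1"
  shows "risk_profile k r t < risk_profile k r 1"
  using risk_profile_decreasing[OF k r, of 1 t] risk_profile_neg[OF k r, of t] G t
  by (cases "t \<le> 1 + r") auto

text \<open>
  Now the limit \<open>0\<close> at infinity exceeds the value at \<open>1\<close>, so the profile regains that value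
  beyond its minimum, and strict monotonicity on both sides excludes any further crossing
  except \<open>1\<close> itself.
\<close>

lemma risk_profile_crossing:
  assumes k: "k > 0" and r: "r > 0" and G: "risk_profile k r 1 < 0"
  obtains c where "c > 1"
    "\<And>t. t > 1 \<Longrightarrow> risk_profile k r t = risk_profile k r 1 \<longleftrightarrow> t = c"
    "\<And>t. t > 0 \<Longrightarrow> risk_profile k r t < risk_profile k r 1 \<longleftrightarrow> 1 < t \<and> t < c"
proof -
  let ?G = "risk_profile k r"
  have "(?G \<longlongrightarrow> 0) at_top"
    unfolding risk_profile_def using k by real_asymp
  hence "eventually (\<lambda>t. ?G 1 < ?G t) at_top"
    using G by (rule order_tendstoD)
  with eventually_gt_at_top[of "1 + r"]
  have "eventually (\<lambda>t. 1 + r < t \<and> ?G 1 < ?G t) at_top"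
    by eventually_elim simp
  then obtain b where b: "1 + r < b" "?G 1 < ?G b"
    by (auto simp: eventually_at_top_linorder)
  \<comment> \<open>The minimum lies strictly below, and \<open>b\<close> strictly above, the level to be crossed.\<close>
  have low: "?G (1 + r) < ?G 1"
    using risk_profile_minimum[OF k r, of 1] r by simp
  obtain c where c: "1 + r \<le> c" "c \<le> b" "?G c = ?G 1"
    using IVT'[of ?G "1 + r" "?G 1" b] low b risk_profile_continuous[of "1 + r" r b k] r by auto
  have c': "1 + r < c" using c low by (cases "c = 1 + r") auto
  have sgn: "(t < 1 \<longrightarrow> ?G 1 < ?G t) \<and> (1 < t \<and> t < c \<longrightarrow> ?G t < ?G 1) \<and> (c < t \<longrightarrow> ?G 1 < ?G t)"
    if "t > 0" for t
    using risk_profile_decreasing[OF k r, of t 1] risk_profile_decreasing[OF k r, of 1 t]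
      risk_profile_increasing[OF k r, of t c] risk_profile_increasing[OF k r, of c t] that c c' r
    by (cases "t \<le> 1 + r") auto
  show ?thesis
  proof (rule that)
    show "c > 1" using c' r by simp
    show "?G t = ?G 1 \<longleftrightarrow> t = c" if "t > 1" for t
      using sgn[of t] c(3) that by (cases t c rule: linorder_cases) auto
    show "?G t < ?G 1 \<longleftrightarrow> 1 < t \<and> t < c" if "t > 0" for t
      using sgn[OF that] c(3) by (cases t c rule: linorder_cases; cases t "1::real" rule: linorder_cases) auto
  qed
qed

text \<open>
  The integrated variance plus the explicit loss between two centred Gaussian densities. The
  terms with variance \<open>v + s\<close> cancel, and factoring out the variance \<open>s\<close> leaves the risk
  profile.
\<close>

lemma gauss_model_risk_gauss_estimator:
  fixes \<mu> :: "'a::euclidean_space"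
  assumes v: "v > 0" and s: "s > 0" and t: "t > 0"
  defines "k \<equiv> real DIM('a) / 2"
  shows "gauss_model_risk v s \<mu> (gauss_estimator (t * s) (\<lambda>x. x)) =
     ennreal (1 / (2 * pi * s) powr k * ((1 / 2) powr k + risk_profile k (v / s) t))"
    and "0 \<le> 1 / (2 * pi * s) powr k * ((1 / 2) powr k + risk_profile k (v / s) t)"
proof -
  let ?g = "\<lambda>x. gauss_density 0 x (0::'a)"
  have ts: "t * s > 0" using s t by simp
  have "density_estimator (gauss_estimator (t * s) (\<lambda>x::'a. x))"
    by (rule gauss_estimator_density_estimator[OF ts]) simp
  note meas = density_estimator_measurable[OF this]
  have g: "?g x = 1 / (2 * pi * s) powr k * (1 / (x / s) powr k)" if "x > 0" for x
    using that s unfolding gauss_density_center k_def[symmetric] by (simp add: mult.assoc flip: powr_mult)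
  have nn: "0 \<le> ?g (2 * s) - ?g (2 * (v + s))"
    using v s gauss_density_center_antimono[of "2 * s" "2 * (v + s)", where 'a = 'a] by simp
  note l2 = l2_loss_gauss[of "v + s" "t * s" "0::'a" 0]
  have eq: "(?g (2 * s) - ?g (2 * (v + s))) + (?g (2 * (v + s)) + ?g (2 * (t * s)) - 2 * ?g (v + s + t * s))
      = 1 / (2 * pi * s) powr k * ((1 / 2) powr k + risk_profile k (v / s) t)"
  proof -
    have "2 * s / s = 2" "2 * (t * s) / s = 2 * t" "(v + s + t * s) / s = v / s + t + 1"
      using s by (simp_all add: field_simps)
    thus ?thesis
      using g[of "2 * s"] g[of "2 * (t * s)"] g[of "v + s + t * s"] v s ts
      by (simp add: risk_profile_def powr_divide algebra_simps)
  qed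
  show "0 \<le> 1 / (2 * pi * s) powr k * ((1 / 2) powr k + risk_profile k (v / s) t)"
    unfolding eq[symmetric] using nn l2(2) v s ts by (intro add_nonneg_nonneg) auto
  have "gauss_model_risk v s \<mu> (gauss_estimator (t * s) (\<lambda>x. x)) =
      ennreal (?g (2 * s) - ?g (2 * (v + s))) +
      l2_loss (gauss_density 0 (v + s)) (gauss_density (0::'a) (t * s))"
    using gauss_model_risk_equivariant[OF v s equivariant_gauss_estimator meas]
    by (simp add: gauss_estimator_def[abs_def])
  also have "\<dots> = ennreal (1 / (2 * pi * s) powr k * ((1 / 2) powr k + risk_profile k (v / s) t))"
    unfolding eq[symmetric] using nn l2 v s ts by (subst ennreal_plus) auto
  finally show "gauss_model_risk v s \<mu> (gauss_estimator (t * s) (\<lambda>x. x)) =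
     ennreal (1 / (2 * pi * s) powr k * ((1 / 2) powr k + risk_profile k (v / s) t))" .
qed

section \<open>Risk comparison of Gaussian predictive density estimators\<close>

lemma dominates_constant_iff:
  assumes "\<And>\<mu>. R \<mu> d1 = r1" "\<And>\<mu>. R \<mu> d2 = r2"
  shows "dominates R d1 d2 \<longleftrightarrow> r1 < r2"
  using assms by (auto simp: dominates_def)

theorem corollary3p1:
  fixes M :: "real ^ 'n \<Rightarrow> 'w measure"
    and X Y :: "'w \<Rightarrow> real ^ 'n"
    and \<sigma>X \<sigma>Y r :: real
    and p :: nat
    and q :: "real ^ 'n \<Rightarrow> real"
    and R :: "real ^ 'n \<Rightarrow> (real ^ 'n \<Rightarrow> real ^ 'n \<Rightarrow> real) \<Rightarrow> ennreal"
    and qhat :: "real \<Rightarrow> (real ^ 'n \<Rightarrow> real ^ 'n) \<Rightarrow> real ^ 'n \<Rightarrow> real ^ 'n \<Rightarrow> real"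
  assumes p: "p = CARD('n)"
    and sigma: "\<sigma>X > 0" "\<sigma>Y > 0"
    and r: "r = \<sigma>X\<^sup>2 / \<sigma>Y\<^sup>2"
    and prob: "\<And>\<mu>. prob_space (M \<mu>)"
    and X: "\<And>\<mu>. distributed (M \<mu>) lborel X (\<lambda>x. ennreal (gauss_density \<mu> (\<sigma>X\<^sup>2) x))"
    and Y: "\<And>\<mu>. distributed (M \<mu>) lborel Y (\<lambda>y. ennreal (q (y - \<mu>)))"
    and indep: "\<And>\<mu>. prob_space.indep_var (M \<mu>) borel X borel Y"
    and q: "q = gauss_density 0 (\<sigma>Y\<^sup>2)"
    and R: "R = density_risk M X q"
    and qhat: "\<And>t \<mu>hat. qhat t \<mu>hat = gauss_estimator (t * \<sigma>Y\<^sup>2) \<mu>hat"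
  shows
    \<comment> \<open>(a)\<close>
    "(\<forall>c>0.
        let a = (1 + c ^ p) / (4 * pi * c\<^sup>2 * \<sigma>Y\<^sup>2) powr (p / 2);
            b = 2 / (2 * pi * (c\<^sup>2 + 1) * \<sigma>Y\<^sup>2) powr (p / 2);
            \<gamma>0 = (c\<^sup>2 + 1) * \<sigma>Y\<^sup>2
        in (\<forall>\<mu>hat \<in> borel_measurable borel. \<forall>\<mu>.
              R \<mu> (qhat (c\<^sup>2) \<mu>hat) < \<infinity> \<and>
              enn2real (R \<mu> (qhat (c\<^sup>2) \<mu>hat)) =
                point_risk M X (\<lambda>\<mu> m. (a - b) + b * reflected_normal_loss \<gamma>0 \<mu> m) \<mu> \<mu>hat) \<and>
           (\<forall>\<mu>hat1 \<in> borel_measurable borel. \<forall>\<mu>hat2 \<in> borel_measurable borel.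
              dominates R (qhat (c\<^sup>2) \<mu>hat1) (qhat (c\<^sup>2) \<mu>hat2) \<longleftrightarrow>
              dominates (point_risk M X (reflected_normal_loss \<gamma>0)) \<mu>hat1 \<mu>hat2)) \<and>
    \<comment> \<open>(b)\<close>
     (\<forall>c>0. \<forall>\<mu>.
        R \<mu> (qhat (c\<^sup>2) (\<lambda>x. x)) < \<infinity> \<and>
        enn2real (R \<mu> (qhat (c\<^sup>2) (\<lambda>x. x))) =
          1 / (2 * pi * \<sigma>Y\<^sup>2) powr (p / 2) *
          ((1 / 2) powr (p / 2) + 1 / (2 * c\<^sup>2) powr (p / 2) - 2 / (r + c\<^sup>2 + 1) powr (p / 2))) \<and>
     (\<forall>c>0. c\<^sup>2 \<noteq> 1 + r \<longrightarrow>
        (\<forall>\<mu>. R \<mu> (qhat (1 + r) (\<lambda>x. x)) < R \<mu> (qhat (c\<^sup>2) (\<lambda>x. x)))) \<and>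
     min_risk_equivariant R (qhat (1 + r) (\<lambda>x. x)) \<and>
     (\<forall>qmre. min_risk_equivariant R qmre \<longrightarrow>
        (\<forall>x. AE y in lborel. qmre y x = gauss_density x (\<sigma>X\<^sup>2 + \<sigma>Y\<^sup>2) y) \<and>
        (\<forall>\<mu>. R \<mu> qmre < \<infinity> \<and>
             enn2real (R \<mu> qmre) =
               1 / (4 * pi * \<sigma>Y\<^sup>2) powr (p / 2) - 1 / (4 * pi * (\<sigma>X\<^sup>2 + \<sigma>Y\<^sup>2)) powr (p / 2)) \<and>
        minimax R qmre) \<and>
    \<comment> \<open>(c)\<close>
     (p \<ge> ln 4 / ln (1 + r / 2) \<longrightarrow>
        (\<forall>c>0. c\<^sup>2 > 1 \<longrightarrow> dominates R (qhat (c\<^sup>2) (\<lambda>x. x)) (qhat 1 (\<lambda>x. x)))) \<and>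
     (p < ln 4 / ln (1 + r / 2) \<longrightarrow>
        (\<exists>k>1.
           (\<forall>t>1. (1 / 2) powr (p / 2) + 2 * (1 / (r + t + 1)) powr (p / 2)
                    - 2 * (1 / (r + 2)) powr (p / 2) - (1 / (2 * t)) powr (p / 2) = 0
                  \<longleftrightarrow> t = k) \<and>
           (\<forall>c>0. dominates R (qhat (c\<^sup>2) (\<lambda>x. x)) (qhat 1 (\<lambda>x. x)) \<longleftrightarrow> 1 < c\<^sup>2 \<and> c\<^sup>2 < k)))"
proof -
  define v s k where "v = \<sigma>X\<^sup>2" and "s = \<sigma>Y\<^sup>2" and "k = real p / 2"
  have v: "v > 0" and s: "s > 0" and k: "k > 0" and rp: "r > 0" and rvs: "r = v / s"
    using sigma by (simp_all add: v_def s_def k_def p r)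
  have dim: "real DIM(real ^ 'n) / 2 = k" by (simp add: k_def p)
  have center: "gauss_density 0 x (0 :: real ^ 'n) = 1 / (2 * pi * x) powr k" for x
    by (simp add: gauss_density_center k_def p)
  have center_double: "gauss_density 0 (2 * x) (0 :: real ^ 'n) = 1 / (4 * pi * x) powr k" for x
    by (simp add: center mult.left_commute mult.assoc)
  have Xm: "X \<in> borel_measurable (M \<mu>)" for \<mu>
    using distributed_measurable[OF X[of \<mu>]] by simp
  have R_model: "R \<mu> Q = gauss_model_risk v s \<mu> Q" if "density_estimator Q" for \<mu> Q
    unfolding R q v_def s_def
    by (rule density_risk_eq_gauss_model_risk[OF X density_estimator_measurable[OF that]])

  have a: "(\<forall>\<mu>hat \<in> borel_measurable borel. \<forall>\<mu>.
              R \<mu> (qhat (c\<^sup>2) \<mu>hat) < \<infinity> \<and>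
              enn2real (R \<mu> (qhat (c\<^sup>2) \<mu>hat)) =
                point_risk M X (\<lambda>\<mu> m. (a - b) + b * reflected_normal_loss \<gamma>0 \<mu> m) \<mu> \<mu>hat) \<and>
           (\<forall>\<mu>hat1 \<in> borel_measurable borel. \<forall>\<mu>hat2 \<in> borel_measurable borel.
              dominates R (qhat (c\<^sup>2) \<mu>hat1) (qhat (c\<^sup>2) \<mu>hat2) \<longleftrightarrow>
              dominates (point_risk M X (reflected_normal_loss \<gamma>0)) \<mu>hat1 \<mu>hat2)"
    if c: "c > 0" and a: "a = (1 + c ^ p) / (4 * pi * c\<^sup>2 * s) powr k"
      and b: "b = 2 / (2 * pi * (c\<^sup>2 + 1) * s) powr k" and \<gamma>0: "\<gamma>0 = (c\<^sup>2 + 1) * s"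
    for c a b \<gamma>0
  proof -
    have cs: "c\<^sup>2 * s > 0" using c s by simp
    have \<gamma>0': "s + c\<^sup>2 * s = \<gamma>0" by (simp add: \<gamma>0 algebra_simps)
    have \<gamma>0_pos: "\<gamma>0 > 0" using cs s by (simp flip: \<gamma>0')
    \<comment> \<open>Here \<open>a\<close> is the sum of the squared norms, and \<open>b\<close> is twice the peak of the cross term.\<close>
    have b': "2 * gauss_density 0 \<gamma>0 (0 :: real ^ 'n) = b"
      unfolding center b \<gamma>0 by (simp add: mult.assoc)
    have b_pos: "b > 0" using b' gauss_density_pos[OF \<gamma>0_pos, of "0 :: real ^ 'n" 0] by simp
    have "(c\<^sup>2) powr k = (c powr real 2) powr k"
      using c by (simp only: powr_realpow)
    hence "(c\<^sup>2) powr k = c ^ p"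
      using powr_realpow[OF c, of p] unfolding powr_powr k_def by simp
    moreover have "(4 * pi * c\<^sup>2 * s) powr k = (c\<^sup>2) powr k * (4 * pi * s) powr k"
      using s by (simp add: mult_ac flip: powr_mult)
    ultimately have a': "gauss_density 0 (2 * s) (0 :: real ^ 'n) +
        gauss_density 0 (2 * (c\<^sup>2 * s)) (0 :: real ^ 'n) = a"
      unfolding center a using c s by (simp add: field_simps)
    have risk: "R \<mu> (qhat (c\<^sup>2) d) =
        ennreal ((a - b) + b * point_risk M X (reflected_normal_loss \<gamma>0) \<mu> d)"
      and nn: "0 \<le> (a - b) + b * point_risk M X (reflected_normal_loss \<gamma>0) \<mu> d"
      if d: "d \<in> borel_measurable borel" for \<mu> d
      using density_risk_gauss_estimator[where M = M and \<mu> = \<mu>, OF prob Xm s cs d]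
        point_risk_affine[where M = M and \<mu> = \<mu>, OF prob Xm \<gamma>0_pos d, of "a - b" b]
      unfolding \<gamma>0' a' b' by (simp_all add: R q qhat flip: s_def)
    have cmp: "R \<mu> (qhat (c\<^sup>2) d1) \<le> R \<mu> (qhat (c\<^sup>2) d2) \<longleftrightarrow>
        point_risk M X (reflected_normal_loss \<gamma>0) \<mu> d1 \<le> point_risk M X (reflected_normal_loss \<gamma>0) \<mu> d2"
      if "d1 \<in> borel_measurable borel" "d2 \<in> borel_measurable borel" for \<mu> d1 d2
      using b_pos nn[OF that(2), of \<mu>] by (simp add: risk that ennreal_le_iff)
    have cmp_less: "R \<mu> (qhat (c\<^sup>2) d1) < R \<mu> (qhat (c\<^sup>2) d2) \<longleftrightarrow>
        point_risk M X (reflected_normal_loss \<gamma>0) \<mu> d1 < point_risk M X (reflected_normal_loss \<gamma>0) \<mu> d2"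
      if "d1 \<in> borel_measurable borel" "d2 \<in> borel_measurable borel" for \<mu> d1 d2
      using cmp[OF that(2,1)] by (simp flip: not_le)
    show ?thesis
      unfolding dominates_def
      by (simp add: cmp cmp_less)
         (simp add: risk nn point_risk_affine[where M = M, OF prob Xm \<gamma>0_pos])
  qed

  have gauss_risk: "R \<mu> (qhat t (\<lambda>x. x)) =
      ennreal (1 / (2 * pi * s) powr k * ((1 / 2) powr k + risk_profile k r t))"
    and gauss_risk_nonneg: "0 \<le> 1 / (2 * pi * s) powr k * ((1 / 2) powr k + risk_profile k r t)"
    if "t > 0" for t \<mu>
    using gauss_model_risk_gauss_estimator(1)[OF v s that, of \<mu>]
      gauss_model_risk_gauss_estimator(2)[OF v s that, where 'a = "real ^ 'n"]
      R_model[OF gauss_estimator_density_estimator[of "t * s" "\<lambda>x. x"], of \<mu>] s that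
    unfolding dim by (simp_all add: qhat rvs flip: s_def)
  have less_iff: "R \<mu> (qhat t (\<lambda>x. x)) < R \<nu> (qhat u (\<lambda>x. x)) \<longleftrightarrow> risk_profile k r t < risk_profile k r u"
    if "t > 0" "u > 0" for t u \<mu> \<nu>
  proof -
    have "1 / (2 * pi * s) powr k > 0" using s by simp
    thus ?thesis
      unfolding gauss_risk[OF that(1)] gauss_risk[OF that(2)] ennreal_less_iff[OF gauss_risk_nonneg[OF that(1)]]
      by (simp only: mult_less_cancel_left_pos add_less_cancel_left)
  qed
  have dom_iff: "dominates R (qhat t (\<lambda>x. x)) (qhat 1 (\<lambda>x. x)) \<longleftrightarrow>
      risk_profile k r t < risk_profile k r 1" if "t > 0" for t
    unfolding less_iff[OF that zero_less_one, of 0 0, symmetric]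
    by (rule dominates_constant_iff) (simp_all add: gauss_risk that)

  have qhat_mre: "qhat (1 + r) (\<lambda>x. x) = gauss_estimator (v + s) (\<lambda>x. x)"
    using s by (simp add: qhat rvs algebra_simps flip: s_def)
  note mre = gauss_min_risk_equivariant[OF v s R_model]
  have mre_nonneg: "0 \<le> gauss_density 0 (2 * s) (0 :: real ^ 'n) - gauss_density 0 (2 * (v + s)) (0 :: real ^ 'n)"
    using v s gauss_density_center_antimono[of "2 * s" "2 * (v + s)", where 'a = "real ^ 'n"] by simp

  have b1: "R \<mu> (qhat (c\<^sup>2) (\<lambda>x. x)) < \<infinity> \<and>
        enn2real (R \<mu> (qhat (c\<^sup>2) (\<lambda>x. x))) =
          1 / (2 * pi * s) powr k *
          ((1 / 2) powr k + 1 / (2 * c\<^sup>2) powr k - 2 / (r + c\<^sup>2 + 1) powr k)" if "c > 0" for c \<mu>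
    using gauss_risk[of "c\<^sup>2" \<mu>] gauss_risk_nonneg[of "c\<^sup>2"] that
    by (simp add: risk_profile_def add_diff_eq)
  have b2: "R \<mu> (qhat (1 + r) (\<lambda>x. x)) < R \<mu> (qhat (c\<^sup>2) (\<lambda>x. x))" if "c > 0" "c\<^sup>2 \<noteq> 1 + r" for c \<mu>
    using less_iff[of "1 + r" "c\<^sup>2" \<mu> \<mu>] risk_profile_minimum[OF k rp _ that(2)] that rp by simp
  have b3: "(\<forall>x. AE y in lborel. qmre y x = gauss_density x (v + s) y) \<and>
        (\<forall>\<mu>. R \<mu> qmre < \<infinity> \<and>
             enn2real (R \<mu> qmre) = 1 / (4 * pi * s) powr k - 1 / (4 * pi * (v + s)) powr k) \<and>
        minimax R qmre" if "min_risk_equivariant R qmre" for qmre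
    using mre(3,4)[OF _ that] mre(2)[OF _ that, unfolded center_double]
      mre_nonneg[unfolded center_double] by simp

  have eqn: "(1 / 2) powr k + 2 * (1 / (r + t + 1)) powr k - 2 * (1 / (r + 2)) powr k - (1 / (2 * t)) powr k = 0
      \<longleftrightarrow> risk_profile k r t = risk_profile k r 1" if "t > 1" for t
    using that rp by (auto simp: risk_profile_def powr_divide add.assoc)
  have c1: "dominates R (qhat (c\<^sup>2) (\<lambda>x. x)) (qhat 1 (\<lambda>x. x))"
    if "p \<ge> ln 4 / ln (1 + r / 2)" "c > 0" "c\<^sup>2 > 1" for c
    using risk_profile_below_1[OF k rp _ that(3)] that risk_profile_1_nonneg_iff[OF rp, of p]
      dom_iff[of "c\<^sup>2"] by (simp add: k_def)
  have c2: "\<exists>k'>1.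
           (\<forall>t>1. (1 / 2) powr k + 2 * (1 / (r + t + 1)) powr k
                    - 2 * (1 / (r + 2)) powr k - (1 / (2 * t)) powr k = 0
                  \<longleftrightarrow> t = k') \<and>
           (\<forall>c>0. dominates R (qhat (c\<^sup>2) (\<lambda>x. x)) (qhat 1 (\<lambda>x. x)) \<longleftrightarrow> 1 < c\<^sup>2 \<and> c\<^sup>2 < k')"
    if "p < ln 4 / ln (1 + r / 2)"
  proof -
    have "risk_profile k r 1 < 0"
      using that risk_profile_1_nonneg_iff[OF rp, of p] by (simp add: k_def)
    then obtain k' where k': "k' > 1"
      "\<And>t. t > 1 \<Longrightarrow> risk_profile k r t = risk_profile k r 1 \<longleftrightarrow> t = k'"
      "\<And>t. t > 0 \<Longrightarrow> risk_profile k r t < risk_profile k r 1 \<longleftrightarrow> 1 < t \<and> t < k'"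
      using risk_profile_crossing[OF k rp] by metis
    thus ?thesis
      using eqn dom_iff by (intro exI[of _ k'] conjI allI impI) (simp_all only: zero_less_power)
  qed
  show ?thesis
    unfolding Let_def v_def[symmetric] s_def[symmetric] k_def[symmetric]
    using a b1 b2 b3 c1 c2 mre(1) qhat_mre by auto
qed

end
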